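(* For any integer $n\ge0$, $$\widetilde{A}_n(q,t)=\sum_{\sigma\in\widetilde{\mathfrak{S}}_n}q^{\mathrm{maj}(\sigma)-\mathrm{exc}(\sigma)}t^{\mathrm{exc}(\sigma)+1}.$$
   Context: For $\pi\in\mathfrak{S}_k$, $\mathrm{maj}(\pi)=\sum_{i:\pi_i>\pi_{i+1}}i$ and $\mathrm{exc}(\pi)=|\{i:\pi_i>i\}|$. For $k\ge1$ put $A_k(q,t)=\sum_{\pi\in\mathfrak{S}_k}q^{\mathrm{maj}(\pi)-\mathrm{exc}(\pi)}t^{\mathrm{exc}(\pi)}$. The $q$-binomial Eulerian polynomial is $$\widetilde A_n(q,t)=1+t\sum_{k=1}^n\begin{bmatrix}n\\k\end{bmatrix}_qA_k(q,t),$$ where $\begin{bmatrix}n\\k\end{bmatrix}_q=\frac{[n]_q!}{[k]_q![n-k]_q!}$, $[m]_q!=\prod_{i=1}^m[i]_q$, $[i]_q=1+q+\cdots+q^{i-1}$. A decorated permutation of $[n]$ is a permutation of a subset $S\subseteq[n]$; its one-line notation is the word $\sigma=\sigma_1\cdots\sigma_n$ over $\{0,1,\dots,n\}$ where $\sigma_i$ is the image of $i$ if $i\in S$ and $\sigma_i=0$ if $i\notin S$. $\widetilde{\mathfrak{S}}_n$ is the set of decorated permutations of $[n]$ and $\theta=00\cdots0$ is the one with $S=\emptyset$. For $\sigma\in\widetilde{\mathfrak{S}}_n$ with $\sigma\ne\theta$ set $\mathrm{exc}(\sigma)=|\{i\in[n]:i<\sigma_i\}|$ and $\mathrm{maj}(\sigma)=\sum_{i\in[n-1]:\sigma_i>\sigma_{i+1}}i$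 (comparison of integers); set $\mathrm{exc}(\theta)=\mathrm{maj}(\theta)=-1$. *)

theory Defs
  imports "HOL-Computational_Algebra.Polynomial_Factorial" "HOL-Combinatorics.Permutations"
begin

text \<open>
  Generating functions are taken in the field \<open>\<rat>(q,t)\<close>, constructed as the fraction field of
  \<open>\<int>[q][t]\<close>. There the $q$-binomial coefficients are honest quotients and integer exponents
  make sense without truncation; since \<open>\<int>[q][t]\<close> embeds in its fraction field, an equation
  between two polynomials holds in the one iff it holds in the other.
\<close>

type_synonym ratfun = "int poly poly fract"

definition q_ind :: ratfun where
  "q_ind = to_fract [:[:0, 1:]:]"

definition t_ind :: ratfun where
  "t_ind = to_fract [:0, 1:]"

definition q_bracket :: "'a::field \<Rightarrow> nat \<Rightarrow> 'a" where
  "q_bracket q i = (\<Sum>j<i. q ^ j)"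

definition q_fact :: "'a::field \<Rightarrow> nat \<Rightarrow> 'a" where
  "q_fact q m = (\<Prod>i=1..m. q_bracket q i)"

definition q_binomial :: "'a::field \<Rightarrow> nat \<Rightarrow> nat \<Rightarrow> 'a" where
  "q_binomial q n k = q_fact q n / (q_fact q k * q_fact q (n - k))"

text \<open>
  A word \<open>w\<^sub>1\<dots>w\<^sub>n\<close> over the natural numbers is represented by a function on \<open>nat\<close>; only its
  values on \<open>{1..n}\<close> matter. A permutation of \<open>[k]\<close> is identified with its one-line notation.
\<close>

definition word_exc :: "nat \<Rightarrow> (nat \<Rightarrow> nat) \<Rightarrow> nat" where
  "word_exc n w = card {i \<in> {1..n}. w i > i}"

definition word_maj :: "nat \<Rightarrow> (nat \<Rightarrow> nat) \<Rightarrow> nat" where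
  "word_maj n w = (\<Sum>i | i \<in> {1..<n} \<and> w i > w (i + 1). i)"

definition Eulerian_qt :: "'a::field \<Rightarrow> 'a \<Rightarrow> nat \<Rightarrow> 'a" where
  "Eulerian_qt q t k =
     (\<Sum>\<pi> | \<pi> permutes {1..k}.
        q powi (int (word_maj k \<pi>) - int (word_exc k \<pi>)) * t powi int (word_exc k \<pi>))"

definition q_binomial_Eulerian :: "'a::field \<Rightarrow> 'a \<Rightarrow> nat \<Rightarrow> 'a" where
  "q_binomial_Eulerian q t n = 1 + t * (\<Sum>k=1..n. q_binomial q n k * Eulerian_qt q t k)"

text \<open>
  The set \<open>S\<close> must be recorded separately: \<open>\<pi> permutes S\<close> makes \<open>\<pi>\<close> the identity outside \<open>S\<close>,
  so \<open>\<pi>\<close> alone does not distinguish a fixed point from a position outside \<open>S\<close>.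
\<close>

type_synonym dec_perm = "nat set \<times> (nat \<Rightarrow> nat)"

definition dec_perms :: "nat \<Rightarrow> dec_perm set" where
  "dec_perms n = {(S, \<pi>). S \<subseteq> {1..n} \<and> \<pi> permutes S}"

definition dec_theta :: dec_perm where
  "dec_theta = ({}, id)"

definition one_line :: "dec_perm \<Rightarrow> nat \<Rightarrow> nat" where
  "one_line \<sigma> i = (if i \<in> fst \<sigma> then snd \<sigma> i else 0)"

definition dec_exc :: "nat \<Rightarrow> dec_perm \<Rightarrow> int" where
  "dec_exc n \<sigma> = (if \<sigma> = dec_theta then -1 else int (word_exc n (one_line \<sigma>)))"

definition dec_maj :: "nat \<Rightarrow> dec_perm \<Rightarrow> int" where
  "dec_maj n \<sigma> = (if \<sigma> = dec_theta then -1 else int (word_maj n (one_line \<sigma>)))"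

lemma finite_dec_perms: "finite (dec_perms n)"
proof -
  have "dec_perms n = Sigma (Pow {1..n}) (\<lambda>S. {\<pi>. \<pi> permutes S})"
    by (auto simp: dec_perms_def)
  moreover have "finite \<dots>"
    by (intro finite_SigmaI finite_permutations) (auto intro: finite_subset)
  ultimately show ?thesis by simp
qed

end

theory Submission
  imports Defs
begin

text \<open>
  Fix the permutation \<open>w \<in> \<SS>\<^sub>k\<close> obtained by standardising the nonzero letters of a decorated
  permutation. Inserting zeros into \<open>w\<close> does not change \<open>exc\<close>, so everything reduces to
  the claim that the sum of \<open>q\<^bsup>maj\<^esup>\<close> over all ways of inserting \<open>n - k\<close> zeros is
  \<open>q\<^bsup>maj(w)\<^esup>\<close> times a $q$-binomial coefficient (a case of the shuffle theorem of Garsia and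
  Gessel). Separating the insertions by their last letter, those ending in \<open>0\<close> contribute
  \<open>q\<^bsup>k + maj(w)\<^esup>\<close> times the coefficient of \<open>(n - 1, k)\<close>, those ending in \<open>w\<^sub>k\<close>
  contribute \<open>q\<^bsup>maj(w)\<^esup>\<close> times that of \<open>(n - 1, k - 1)\<close>; deleting the last letter turns these
  two formulas into the two $q$-Pascal recurrences.
\<close>

section \<open>Gaussian binomials: the two q-Pascal recurrences and the factorial quotient\<close>

text \<open>Vanishes for \<open>k > n\<close>, unlike \<^const>\<open>q_binomial\<close>, where \<open>n - k\<close> is truncated.\<close>

fun gauss_binomial :: "'a::comm_semiring_1 \<Rightarrow> nat \<Rightarrow> nat \<Rightarrow> 'a" where
  "gauss_binomial q n 0 = 1"
| "gauss_binomial q 0 (Suc k) = 0"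
| "gauss_binomial q (Suc n) (Suc k) = gauss_binomial q n k + q ^ Suc k * gauss_binomial q n (Suc k)"

lemma gauss_binomial_eq_0: "n < k \<Longrightarrow> gauss_binomial q n k = 0"
  by (induction q n k rule: gauss_binomial.induct) auto

text \<open>Companion of the defining recurrence, with the power of \<open>q\<close> on the other
  term. Expand the left side by the defining recurrence, apply the induction hypothesis to both
  summands, and regroup the four terms by the defining recurrence.\<close>

lemma gauss_binomial_Suc_Suc':
  "k \<le> n \<Longrightarrow> gauss_binomial q (Suc n) (Suc k) =
     gauss_binomial q n (Suc k) + q ^ (n - k) * gauss_binomial q n k"
proof (induction n arbitrary: k)
  case 0
  then show ?case by simp
next
  case (Suc n)
  show ?case
  proof (cases k)
    case 0
    have "gauss_binomial q (Suc (Suc n)) (Suc 0) = 1 + q * gauss_binomial q (Suc n) (Suc 0)"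
      by simp
    also have "gauss_binomial q (Suc n) (Suc 0) = gauss_binomial q n (Suc 0) + q ^ n"
      using Suc.IH[of 0] by simp
    also have "1 + q * \<dots> = gauss_binomial q (Suc n) (Suc 0) + q ^ Suc n"
      by (simp add: algebra_simps)
    finally show ?thesis using 0 by simp
  next
    case (Suc j)
    show ?thesis
    proof (cases "k \<le> n")
      case True
      define a b c where "a = gauss_binomial q n j" and "b = gauss_binomial q n k"
        and "c = gauss_binomial q n (Suc k)"
      have pow: "q ^ (n - j) = q * q ^ (n - k)"
        using Suc True by (metis Suc_diff_le diff_Suc_Suc power_Suc)
      have 1: "gauss_binomial q (Suc n) k = b + q ^ (n - j) * a"
        using Suc.IH[of j] Suc True by (simp add: a_def b_def)
      have 2: "gauss_binomial q (Suc n) (Suc k) = c + q ^ (n - k) * b"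
        using Suc.IH[of k] True by (simp add: b_def c_def)
      have 3: "gauss_binomial q (Suc n) k = a + q ^ k * b"
        using Suc by (simp add: a_def b_def)
      have 4: "gauss_binomial q (Suc n) (Suc k) = b + q ^ Suc k * c"
        by (simp add: b_def c_def)
      have "gauss_binomial q (Suc (Suc n)) (Suc k) =
          b + q ^ (n - j) * a + q ^ Suc k * (c + q ^ (n - k) * b)"
        using 1 2 by simp
      also have "\<dots> = (b + q ^ Suc k * c) + q ^ (n - j) * (a + q ^ k * b)"
        unfolding pow by (simp add: algebra_simps)
      also have "\<dots> = gauss_binomial q (Suc n) (Suc k) + q ^ (Suc n - k) * gauss_binomial q (Suc n) k"
        unfolding 3 4 using Suc by simp
      finally show ?thesis .
    next
      case False
      then have "k = Suc n" using Suc.prems by simp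
      then show ?thesis by (simp add: gauss_binomial_eq_0)
    qed
  qed
qed

lemma q_bracket_Suc: "q_bracket q (Suc n) = 1 + q * q_bracket q n"
  by (simp add: q_bracket_def sum.lessThan_Suc_shift sum_distrib_left del: sum.lessThan_Suc)

lemma q_bracket_add: "q_bracket q (m + n) = q_bracket q m + q ^ m * q_bracket q n"
proof (induction m)
  case 0
  then show ?case by (simp add: q_bracket_def)
next
  case (Suc m)
  then show ?case by (simp add: q_bracket_Suc algebra_simps)
qed

lemma q_fact_0 [simp]: "q_fact q 0 = 1"
  by (simp add: q_fact_def)

lemma q_fact_Suc: "q_fact q (Suc n) = q_bracket q (Suc n) * q_fact q n"
  by (simp add: q_fact_def)

text \<open>Kept free of division, so that it holds even where some \<open>q_bracket\<close>
  vanishes. In the induction the two summands of the defining recurrence contribute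
  \<open>q_bracket q a\<close> and \<open>q ^ a * q_bracket q b\<close> times
  \<open>q_fact q n\<close>, and these add up by \<open>q_bracket_add\<close>.\<close>

lemma gauss_binomial_mult_q_fact:
  "gauss_binomial q (a + b) a * (q_fact q a * q_fact q b) = q_fact q (a + b)"
proof (induction "a + b" arbitrary: a b)
  case 0
  then show ?case by simp
next
  case (Suc n)
  show ?case
  proof (cases a)
    case 0
    then show ?thesis by simp
  next
    case a: (Suc c)
    show ?thesis
    proof (cases b)
      case 0
      have "gauss_binomial q (c + 0) c * (q_fact q c * q_fact q 0) = q_fact q (c + 0)"
        using Suc(1)[of c 0] Suc(2) a 0 by simp
      then show ?thesis using a 0
        by (auto simp: gauss_binomial_eq_0 q_fact_Suc mult.left_commute)
    next
      case b: (Suc d)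
      have n: "n = c + b" "n = a + d" using Suc(2) a b by auto
      have 1: "gauss_binomial q n c * (q_fact q c * q_fact q b) = q_fact q n"
        using Suc(1)[OF n(1)] by (simp flip: n(1))
      have 2: "gauss_binomial q n a * (q_fact q a * q_fact q d) = q_fact q n"
        using Suc(1)[OF n(2)] by (simp flip: n(2))
      have "gauss_binomial q (a + b) a = gauss_binomial q n c + q ^ a * gauss_binomial q n a"
        unfolding Suc(2)[symmetric] by (simp only: a gauss_binomial.simps)
      then have "gauss_binomial q (a + b) a * (q_fact q a * q_fact q b) = q_bracket q a * (gauss_binomial q n c * (q_fact q c * q_fact q b)) +
          q ^ a * q_bracket q b * (gauss_binomial q n a * (q_fact q a * q_fact q d))"
        using a b by (simp add: q_fact_Suc algebra_simps)
      also have "\<dots> = q_bracket q (a + b) * q_fact q n"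
        unfolding 1 2 by (simp add: q_bracket_add algebra_simps)
      also have "\<dots> = q_fact q (a + b)"
        using Suc(2) q_fact_Suc by metis
      finally show ?thesis .
    qed
  qed
qed

lemma q_binomial_eq_gauss_binomial:
  assumes "\<And>i. i > 0 \<Longrightarrow> q_bracket q i \<noteq> 0" and "k \<le> n"
  shows "q_binomial q n k = gauss_binomial q n k"
proof -
  have nz: "q_fact q m \<noteq> 0" for m
    using assms(1) by (simp add: q_fact_def)
  have "gauss_binomial q n k * (q_fact q k * q_fact q (n - k)) = q_fact q n"
    using gauss_binomial_mult_q_fact[of q k "n - k"] assms(2) by simp
  then show ?thesis
    unfolding q_binomial_def using nz by (simp add: field_simps)
qed

section \<open>Zero insertions indexed by k-subsets\<close>

text \<open>For \<open>S\<close> inside \<open>{1..n}\<close>, its restriction to \<open>S\<close>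
  is the increasing bijection onto \<open>{1..card S}\<close>. It compresses positions as well as
  letters.\<close>

definition rank_in :: "nat set \<Rightarrow> nat \<Rightarrow> nat" where
  "rank_in S i = card (S \<inter> {1..i})"

text \<open>\<open>S\<close> holds the positions that receive the letters of \<open>w\<close> in
  order, so the shuffles of \<open>w\<close> with zeros are indexed by subsets.\<close>

definition insert_zeros :: "nat set \<Rightarrow> (nat \<Rightarrow> nat) \<Rightarrow> nat \<Rightarrow> nat" where
  "insert_zeros S w i = (if i \<in> S then w (rank_in S i) else 0)"

definition k_subsets :: "nat \<Rightarrow> nat \<Rightarrow> nat set set" where
  "k_subsets n k = {S. S \<subseteq> {1..n} \<and> card S = k}"

lemma finite_k_subsets [simp]: "finite (k_subsets n k)"
  by (rule finite_subset[of _ "Pow {1..n}"]) (auto simp: k_subsets_def)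

lemma k_subsets_0: "k_subsets n 0 = {{}}"
  by (auto simp: k_subsets_def dest: finite_subset[OF _ finite_atLeastAtMost])

lemma k_subsets_0_Suc: "k_subsets 0 (Suc k) = {}"
  by (auto simp: k_subsets_def)

text \<open>Membership of \<open>Suc n\<close> decides whether the last letter is an inserted zero
  or a letter of \<open>w\<close>; this is the split by the last letter.\<close>

lemma sum_k_subsets_Suc:
  fixes f :: "nat set \<Rightarrow> 'a::comm_monoid_add"
  shows "(\<Sum>S\<in>k_subsets (Suc n) (Suc k). f S) =
    (\<Sum>S\<in>k_subsets n (Suc k). f S) + (\<Sum>S\<in>k_subsets n k. f (insert (Suc n) S))"
proof -
  have *: "k_subsets (Suc n) (Suc k) = k_subsets n (Suc k) \<union> insert (Suc n) ` k_subsets n k"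
    (is "?L = ?A \<union> ?B")
  proof (intro equalityI subsetI)
    fix S assume S: "S \<in> ?L"
    then have fin: "finite S" by (auto simp: k_subsets_def intro: finite_subset)
    show "S \<in> ?A \<union> ?B"
    proof (cases "Suc n \<in> S")
      case True
      then have "S = insert (Suc n) (S - {Suc n})" by auto
      moreover have "S - {Suc n} \<in> k_subsets n k"
        using S True fin by (auto simp: k_subsets_def atLeastAtMostSuc_conv)
      ultimately show ?thesis by blast
    next
      case False
      then show ?thesis using S by (auto simp: k_subsets_def atLeastAtMostSuc_conv)
    qed
  next
    fix S assume "S \<in> ?A \<union> ?B"
    then show "S \<in> ?L"
    proof
      assume "S \<in> ?A"
      then show ?thesis by (auto simp: k_subsets_def)
    next
      assume "S \<in> ?B"
      then obtain T where T: "S = insert (Suc n) T" "T \<subseteq> {1..n}" "card T = k"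
        by (auto simp: k_subsets_def)
      then have "finite T" "Suc n \<notin> T" by (auto intro: finite_subset)
      then show ?thesis using T by (auto simp: k_subsets_def)
    qed
  qed
  have "inj_on (insert (Suc n)) (k_subsets n k)"
  proof (rule inj_onI)
    fix S T assume "S \<in> k_subsets n k" "T \<in> k_subsets n k" "insert (Suc n) S = insert (Suc n) T"
    moreover from this have "Suc n \<notin> S" "Suc n \<notin> T" by (auto simp: k_subsets_def)
    ultimately show "S = T" by (simp add: insert_ident)
  qed
  moreover have "k_subsets n (Suc k) \<inter> insert (Suc n) ` k_subsets n k = {}"
    by (auto simp: k_subsets_def)
  ultimately show ?thesis
    unfolding * by (subst sum.union_disjoint) (auto simp: sum.reindex)
qed

lemma word_maj_Suc:
  assumes "n > 0"
  shows "word_maj (Suc n) w = word_maj n w + (if w n > w (Suc n) then n else 0)"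
proof -
  have "{i. i \<in> {1..<Suc n} \<and> w i > w (i + 1)} =
      {i. i \<in> {1..<n} \<and> w i > w (i + 1)} \<union> (if w n > w (Suc n) then {n} else {})"
    using assms by (auto simp: less_Suc_eq)
  then show ?thesis
    unfolding word_maj_def by (simp add: sum.union_disjoint)
qed

lemma word_maj_le_1 [simp]: "word_maj (Suc 0) w = 0" "word_maj 0 w = 0"
  by (auto simp: word_maj_def)

lemma word_maj_cong:
  assumes "\<And>i. i \<in> {1..n} \<Longrightarrow> v i = w i"
  shows "word_maj n v = word_maj n w"
  unfolding word_maj_def using assms by (intro sum.cong) auto

lemma rank_in_insert:
  assumes "i < m"
  shows "rank_in (insert m S) i = rank_in S i"
proof -
  have "insert m S \<inter> {1..i} = S \<inter> {1..i}" using assms by auto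
  then show ?thesis by (simp add: rank_in_def)
qed

lemma rank_in_max:
  assumes "S \<in> k_subsets n k" "n \<le> m"
  shows "rank_in S m = k"
proof -
  have "S \<inter> {1..m} = S" using assms by (auto simp: k_subsets_def)
  then show ?thesis using assms by (simp add: rank_in_def k_subsets_def)
qed

lemma insert_Suc_in_k_subsets: "S \<in> k_subsets n k \<Longrightarrow> insert (Suc n) S \<in> k_subsets (Suc n) (Suc k)"
  by (auto simp: k_subsets_def) (subst card_insert_disjoint, auto intro: finite_subset)

lemma insert_zeros_insert:
  "i \<le> n \<Longrightarrow> insert_zeros (insert (Suc n) S) w i = insert_zeros S w i"
  by (auto simp: insert_zeros_def rank_in_insert)

lemma insert_zeros_insert_last:
  "S \<in> k_subsets n k \<Longrightarrow> insert_zeros (insert (Suc n) S) w (Suc n) = w (Suc k)"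
  by (simp add: insert_zeros_def rank_in_max[OF insert_Suc_in_k_subsets])

lemma insert_zeros_beyond:
  "S \<in> k_subsets n k \<Longrightarrow> i > n \<Longrightarrow> insert_zeros S w i = 0"
  by (auto simp: insert_zeros_def k_subsets_def)

lemma word_maj_insert_zeros_insert:
  "word_maj n (insert_zeros (insert (Suc n) S) w) = word_maj n (insert_zeros S w)"
  by (rule word_maj_cong) (simp add: insert_zeros_insert)

section \<open>The distribution of maj over zero insertions\<close>

text \<open>The words have length \<open>Suc n\<close> and end in \<open>0\<close> in the first sum,
  in \<open>w (Suc k)\<close> in the second. Deleting the last letter can lead to either type, hence
  the simultaneous induction. Positivity of \<open>w\<close> makes every passage from a letter to a
  zero a descent.\<close>

lemma sum_insert_zeros_last:
  fixes q :: "'a::comm_semiring_1"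
  assumes pos: "\<And>i. i > 0 \<Longrightarrow> w i > 0"
  shows "(\<Sum>S\<in>k_subsets n k. q ^ word_maj (Suc n) (insert_zeros S w)) =
           q ^ (k + word_maj k w) * gauss_binomial q n k \<and>
         (\<Sum>S\<in>k_subsets n k. q ^ word_maj (Suc n) (insert_zeros (insert (Suc n) S) w)) =
           q ^ word_maj (Suc k) w * gauss_binomial q n k"
proof (induction n arbitrary: k)
  case 0
  show ?case by (cases k) (simp_all add: k_subsets_0 k_subsets_0_Suc)
next
  case (Suc n)
  \<comment> \<open>The two sums of the induction hypothesis: words ending in a zero and words
    ending in a letter of \<open>w\<close>.\<close>
  define Z L where "Z k = (\<Sum>S\<in>k_subsets n k. q ^ word_maj (Suc n) (insert_zeros S w))"
    and "L k = (\<Sum>S\<in>k_subsets n k. q ^ word_maj (Suc n) (insert_zeros (insert (Suc n) S) w))" for k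
  have Z: "Z k = q ^ (k + word_maj k w) * gauss_binomial q n k"
    and L: "L k = q ^ word_maj (Suc k) w * gauss_binomial q n k" for k
    using Suc.IH by (auto simp: Z_def L_def)
  let ?d = "\<lambda>k. if w (Suc k) > w (Suc (Suc k)) then Suc n else 0"
  \<comment> \<open>The two digits tell whether positions \<open>Suc n\<close> and
    \<open>Suc (Suc n)\<close> hold a zero (0) or a letter of \<open>w\<close> (1). Only 10, and 11
    at a descent of \<open>w\<close>, add the descent position \<open>Suc n\<close>.\<close>
  have 00: "word_maj (Suc (Suc n)) (insert_zeros S w) = word_maj (Suc n) (insert_zeros S w)"
    if "S \<in> k_subsets n k" for S k
    using that by (simp add: word_maj_Suc insert_zeros_beyond)
  have 10: "word_maj (Suc (Suc n)) (insert_zeros (insert (Suc n) S) w) =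
      word_maj (Suc n) (insert_zeros (insert (Suc n) S) w) + Suc n"
    if "S \<in> k_subsets n k" for S k
    using that pos
    by (simp add: word_maj_Suc insert_zeros_insert_last
        insert_zeros_beyond[OF insert_Suc_in_k_subsets])
  have 01: "word_maj (Suc (Suc n)) (insert_zeros (insert (Suc (Suc n)) S) w) =
      word_maj (Suc n) (insert_zeros S w)"
    if "S \<in> k_subsets n k" for S k
    using that
    by (simp add: word_maj_Suc[of "Suc n"] word_maj_insert_zeros_insert insert_zeros_insert
        insert_zeros_beyond)
  have 11: "word_maj (Suc (Suc n)) (insert_zeros (insert (Suc (Suc n)) (insert (Suc n) S)) w) =
      word_maj (Suc n) (insert_zeros (insert (Suc n) S) w) + ?d k"
    if "S \<in> k_subsets n k" for S k
    using that
    by (simp add: word_maj_Suc[of "Suc n"] word_maj_insert_zeros_insert insert_zeros_insert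
        insert_zeros_insert_last insert_zeros_insert_last[OF insert_Suc_in_k_subsets])
  show ?case
  proof (cases k)
    case 0
    have "Z 0 = 1" using Z[of 0] by simp
    then show ?thesis
      using 0 00[of "{}" 0] 01[of "{}" 0] by (simp add: k_subsets_0 Z_def)
  next
    case (Suc j)
    have "(\<Sum>S\<in>k_subsets (Suc n) k. q ^ word_maj (Suc (Suc n)) (insert_zeros S w)) =
        Z k + q ^ Suc n * L j"
      unfolding Suc sum_k_subsets_Suc Z_def L_def sum_distrib_left
      by (intro arg_cong2[where f = "(+)"] sum.cong refl) (simp_all add: 00 10 power_add mult_ac)
    also have "\<dots> = q ^ (k + word_maj k w) * gauss_binomial q (Suc n) k"
    proof (cases "j \<le> n")
      case True
      \<comment> \<open>The weight of the new descent splits into \<open>q ^ k\<close>, as in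
        \<open>Z k\<close>, and \<open>q ^ (n - j)\<close>, as in the second recurrence. For
        \<open>j > n\<close> both sides vanish.\<close>
      then have "Suc n = k + (n - j)" using Suc by simp
      then have "q ^ Suc n = q ^ k * q ^ (n - j)" by (metis power_add)
      then show ?thesis
        unfolding Z L Suc gauss_binomial_Suc_Suc'[OF True] by (simp add: power_add algebra_simps)
    qed (simp add: Suc Z L gauss_binomial_eq_0)
    finally have z: "(\<Sum>S\<in>k_subsets (Suc n) k. q ^ word_maj (Suc (Suc n)) (insert_zeros S w)) =
        q ^ (k + word_maj k w) * gauss_binomial q (Suc n) k" .
    have "(\<Sum>S\<in>k_subsets (Suc n) k.
        q ^ word_maj (Suc (Suc n)) (insert_zeros (insert (Suc (Suc n)) S) w)) = Z k + q ^ ?d j * L j"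
      unfolding Suc sum_k_subsets_Suc Z_def L_def sum_distrib_left
      by (intro arg_cong2[where f = "(+)"] sum.cong refl) (simp_all add: 01 11 power_add mult_ac)
    also have "\<dots> = q ^ word_maj (Suc k) w * gauss_binomial q (Suc n) k"
    \<comment> \<open>At a descent of \<open>w\<close> the second recurrence applies, and the factor
      \<open>q ^ k\<close> is absorbed by \<open>word_maj (Suc k) w\<close>; otherwise the defining
      recurrence applies.\<close>
    proof (cases "w (Suc j) > w (Suc (Suc j))")
      case desc: True
      show ?thesis
      proof (cases "j \<le> n")
        case True
        then have "Suc n = k + (n - j)" using Suc by simp
        then have "q ^ Suc n = q ^ k * q ^ (n - j)" by (metis power_add)
        then show ?thesis using desc
          unfolding Z L Suc gauss_binomial_Suc_Suc'[OF True]
          by (simp add: word_maj_Suc[of "Suc j"] power_add algebra_simps)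
      qed (simp add: Suc Z L gauss_binomial_eq_0)
    next
      case False
      then show ?thesis
        unfolding Z L Suc by (simp add: word_maj_Suc[of "Suc j"] power_add algebra_simps)
    qed
    finally show ?thesis using z by simp
  qed
qed

text \<open>For positive \<open>n\<close> and \<open>k\<close>, the words ending in a zero and those
  ending in \<open>w k\<close> add up by the defining recurrence.\<close>

lemma sum_insert_zeros:
  fixes q :: "'a::comm_semiring_1"
  assumes pos: "\<And>i. i > 0 \<Longrightarrow> w i > 0"
  shows "(\<Sum>S\<in>k_subsets n k. q ^ word_maj n (insert_zeros S w)) =
    q ^ word_maj k w * gauss_binomial q n k"
proof (cases n)
  case 0
  then show ?thesis by (cases k) (simp_all add: k_subsets_0 k_subsets_0_Suc)
next
  case (Suc m)
  note last = sum_insert_zeros_last[where w = w and n = m and q = q, OF pos]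
  show ?thesis
  proof (cases k)
    case 0
    then show ?thesis using Suc last[of 0] by (simp add: k_subsets_0)
  next
    case k: (Suc j)
    show ?thesis
      unfolding Suc k sum_k_subsets_Suc using last
      by (simp add: power_add algebra_simps)
  qed
qed

section \<open>Standardisation of decorated permutations\<close>

lemma strict_mono_on_rank_in:
  assumes "S \<subseteq> {1..n}"
  shows "strict_mono_on S (rank_in S)"
proof (rule strict_mono_onI)
  fix i j assume "i \<in> S" "j \<in> S" "i < j"
  then have "j \<in> S \<inter> {1..j}" "j \<notin> S \<inter> {1..i}" "S \<inter> {1..i} \<subseteq> S \<inter> {1..j}"
    using assms by auto
  then have "S \<inter> {1..i} \<subset> S \<inter> {1..j}" by blast
  then show "rank_in S i < rank_in S j"
    unfolding rank_in_def by (intro psubset_card_mono) auto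
qed

lemma rank_in_pos:
  assumes "S \<subseteq> {1..n}" "i \<in> S"
  shows "rank_in S i > 0"
proof -
  have "i \<in> S \<inter> {1..i}" using assms by auto
  then show ?thesis unfolding rank_in_def card_gt_0_iff by blast
qed

lemma bij_betw_rank_in:
  assumes S: "S \<in> k_subsets n k"
  shows "bij_betw (rank_in S) S {1..k}"
proof -
  have sub: "S \<subseteq> {1..n}" and card: "card S = k" using S by (auto simp: k_subsets_def)
  then have fin: "finite S" by (auto intro: finite_subset)
  have inj: "inj_on (rank_in S) S"
    using strict_mono_on_rank_in[OF sub] strict_mono_on_imp_inj_on by blast
  have "rank_in S ` S \<subseteq> {1..k}"
    using rank_in_pos[OF sub] card fin by (auto simp: rank_in_def Suc_le_eq intro: card_mono)
  then have "rank_in S ` S = {1..k}"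
    using card_image[OF inj] card by (intro card_subset_eq) auto
  then show ?thesis using inj by (simp add: bij_betw_def)
qed

text \<open>This is \<open>\<pi>\<close> conjugated by the order isomorphism
  \<open>rank_in S\<close>, extended by the identity as \<open>permutes\<close> demands.\<close>

definition standardize :: "nat set \<Rightarrow> (nat \<Rightarrow> nat) \<Rightarrow> nat \<Rightarrow> nat" where
  "standardize S \<pi> x =
     (if x \<in> {1..card S} then rank_in S (\<pi> (inv_into S (rank_in S) x)) else x)"

lemma bij_betw_standardize:
  assumes "S \<in> k_subsets n k"
  shows "bij_betw (standardize S) {\<pi>. \<pi> permutes S} {\<pi>. \<pi> permutes {1..k}}"
proof -
  have "card S = k" using assms by (simp add: k_subsets_def)
  then have "standardize S =
      (\<lambda>\<pi> x. if x \<in> {1..k} then rank_in S (\<pi> (inv_into S (rank_in S) x)) else x)"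
    by (auto simp: standardize_def fun_eq_iff)
  then show ?thesis using bij_betw_permutations[OF bij_betw_rank_in[OF assms]] by simp
qed

lemma standardize_rank_in:
  assumes "S \<in> k_subsets n k" "i \<in> S"
  shows "standardize S \<pi> (rank_in S i) = rank_in S (\<pi> i)"
proof -
  have "card S = k" using assms by (simp add: k_subsets_def)
  then show ?thesis
    using bij_betw_rank_in[OF assms(1)] assms(2)
    by (auto simp: standardize_def bij_betw_def)
qed

text \<open>Standardising relabels the nonzero letters increasingly and keeps them positive, so
  every comparison of two letters, zeros included, is preserved.\<close>

lemma word_maj_one_line:
  assumes S: "S \<in> k_subsets n k" and \<pi>: "\<pi> permutes S"
  shows "word_maj n (one_line (S, \<pi>)) = word_maj n (insert_zeros S (standardize S \<pi>))"
proof -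
  have sub: "S \<subseteq> {1..n}" using S by (auto simp: k_subsets_def)
  have img: "\<pi> i \<in> S" if "i \<in> S" for i using \<pi> that by (simp add: permutes_in_image)
  have less: "rank_in S i < rank_in S j \<longleftrightarrow> i < j" if "i \<in> S" "j \<in> S" for i j
    using strict_mono_on_less[OF strict_mono_on_rank_in[OF sub]] that by simp
  have "one_line (S, \<pi>) i > one_line (S, \<pi>) j \<longleftrightarrow>
      insert_zeros S (standardize S \<pi>) i > insert_zeros S (standardize S \<pi>) j" for i j
  proof -
    have "\<pi> i > 0" if "i \<in> S" for i using img[OF that] sub by force
    moreover have "rank_in S (\<pi> i) > 0" if "i \<in> S" for i using img[OF that] rank_in_pos[OF sub] by blast
    ultimately show ?thesis
      by (simp add: one_line_def insert_zeros_def standardize_rank_in[OF S] less img)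
  qed
  then show ?thesis by (simp add: word_maj_def)
qed

text \<open>A zero is never an excedance; on \<open>S\<close> the same increasing map is applied to
  position and value, so excedances correspond under \<open>rank_in S\<close>.\<close>

lemma word_exc_one_line:
  assumes S: "S \<in> k_subsets n k" and \<pi>: "\<pi> permutes S"
  shows "word_exc n (one_line (S, \<pi>)) = word_exc k (standardize S \<pi>)"
proof -
  have sub: "S \<subseteq> {1..n}" using S by (auto simp: k_subsets_def)
  have img: "\<pi> i \<in> S" if "i \<in> S" for i using \<pi> that by (simp add: permutes_in_image)
  have less: "rank_in S i < rank_in S j \<longleftrightarrow> i < j" if "i \<in> S" "j \<in> S" for i j
    using strict_mono_on_less[OF strict_mono_on_rank_in[OF sub]] that by simp
  have bij: "inj_on (rank_in S) S" "rank_in S ` S = {1..k}"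
    using bij_betw_rank_in[OF S] by (auto simp: bij_betw_def)
  have "{i \<in> {1..n}. one_line (S, \<pi>) i > i} = {i \<in> S. \<pi> i > i}"
    using sub by (auto simp: one_line_def split: if_splits)
  moreover have "{j \<in> {1..k}. standardize S \<pi> j > j} = rank_in S ` {i \<in> S. \<pi> i > i}"
    unfolding bij(2)[symmetric] by (auto simp: standardize_rank_in[OF S] less img)
  moreover have "inj_on (rank_in S) {i \<in> S. \<pi> i > i}"
    using bij(1) by (rule inj_on_subset) auto
  ultimately show ?thesis by (simp add: word_exc_def card_image)
qed

section \<open>Summation over decorated permutations\<close>

text \<open>After standardisation exc no longer depends on \<open>S\<close>. Exchanging the sums
  therefore leaves, for each \<open>\<rho>\<close>, an inner sum over \<open>S\<close> that
  \<open>sum_insert_zeros\<close> evaluates.\<close>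

lemma sum_dec_perms_k_subsets:
  fixes q t :: "'a::field"
  assumes q: "q \<noteq> 0"
  shows "(\<Sum>S\<in>k_subsets n k. \<Sum>\<pi> | \<pi> permutes S.
      q powi (int (word_maj n (one_line (S, \<pi>))) - int (word_exc n (one_line (S, \<pi>)))) *
      t ^ word_exc n (one_line (S, \<pi>))) = gauss_binomial q n k * Eulerian_qt q t k"
proof -
  let ?g = "\<lambda>S \<rho>. q powi (int (word_maj n (insert_zeros S \<rho>)) - int (word_exc k \<rho>)) *
      t ^ word_exc k \<rho>"
  have "(\<Sum>\<pi> | \<pi> permutes S.
      q powi (int (word_maj n (one_line (S, \<pi>))) - int (word_exc n (one_line (S, \<pi>)))) *
      t ^ word_exc n (one_line (S, \<pi>))) = (\<Sum>\<rho> | \<rho> permutes {1..k}. ?g S \<rho>)"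
    if "S \<in> k_subsets n k" for S
    unfolding sum.reindex_bij_betw[OF bij_betw_standardize[OF that], symmetric]
    by (intro sum.cong refl) (simp add: word_maj_one_line[OF that] word_exc_one_line[OF that])
  then have "(\<Sum>S\<in>k_subsets n k. \<Sum>\<pi> | \<pi> permutes S.
      q powi (int (word_maj n (one_line (S, \<pi>))) - int (word_exc n (one_line (S, \<pi>)))) *
      t ^ word_exc n (one_line (S, \<pi>))) =
      (\<Sum>S\<in>k_subsets n k. \<Sum>\<rho> | \<rho> permutes {1..k}. ?g S \<rho>)"
    by (rule sum.cong[OF refl])
  also have "\<dots> = (\<Sum>\<rho> | \<rho> permutes {1..k}. \<Sum>S\<in>k_subsets n k. ?g S \<rho>)"
    by (rule sum.swap)
  also have "\<dots> = (\<Sum>\<rho> | \<rho> permutes {1..k}. gauss_binomial q n k *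
      (q powi (int (word_maj k \<rho>) - int (word_exc k \<rho>)) * t powi int (word_exc k \<rho>)))"
  proof (intro sum.cong refl)
    fix \<rho> assume "\<rho> \<in> {\<rho>. \<rho> permutes {1..k}}"
    then have perm: "\<rho> permutes {1..k}" by simp
    \<comment> \<open>Positivity is required beyond \<open>k\<close> too; there
      \<open>\<rho>\<close> is the identity.\<close>
    then have "\<rho> i > 0" if "i > 0" for i
      using that permutes_in_image[OF perm, of i] permutes_not_in[OF perm, of i]
      by (cases "i \<in> {1..k}") auto
    then have shuffle: "(\<Sum>S\<in>k_subsets n k. q ^ word_maj n (insert_zeros S \<rho>)) =
        q ^ word_maj k \<rho> * gauss_binomial q n k"
      by (rule sum_insert_zeros)
    have "(\<Sum>S\<in>k_subsets n k. ?g S \<rho>) =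
        (\<Sum>S\<in>k_subsets n k. q ^ word_maj n (insert_zeros S \<rho>)) *
        (t ^ word_exc k \<rho> / q ^ word_exc k \<rho>)"
      unfolding sum_distrib_right using q
      by (intro sum.cong refl) (simp add: power_int_diff)
    also have "\<dots> = gauss_binomial q n k *
        (q powi (int (word_maj k \<rho>) - int (word_exc k \<rho>)) * t powi int (word_exc k \<rho>))"
      unfolding shuffle using q by (simp add: power_int_diff)
    finally show "(\<Sum>S\<in>k_subsets n k. ?g S \<rho>) = gauss_binomial q n k *
        (q powi (int (word_maj k \<rho>) - int (word_exc k \<rho>)) * t powi int (word_exc k \<rho>))" .
  qed
  finally show ?thesis by (simp add: Eulerian_qt_def sum_distrib_left)
qed

text \<open>Group by \<open>card S\<close>: size 0 gives the summand 1, and each size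
  \<open>k > 0\<close> gives \<open>t\<close> times the k-th term of the polynomial. Nonzero
  brackets turn \<open>gauss_binomial\<close> into the quotient \<open>q_binomial\<close>.\<close>

lemma q_binomial_Eulerian_eq_sum_dec_perms:
  fixes q t :: "'a::field"
  assumes q: "q \<noteq> 0" and bracket: "\<And>i. i > 0 \<Longrightarrow> q_bracket q i \<noteq> 0"
  shows "q_binomial_Eulerian q t n =
    (\<Sum>\<sigma>\<in>dec_perms n. q powi (dec_maj n \<sigma> - dec_exc n \<sigma>) * t powi (dec_exc n \<sigma> + 1))"
proof -
  let ?f = "\<lambda>\<sigma>. q powi (dec_maj n \<sigma> - dec_exc n \<sigma>) * t powi (dec_exc n \<sigma> + 1)"
  let ?h = "\<lambda>S \<pi>.
      q powi (int (word_maj n (one_line (S, \<pi>))) - int (word_exc n (one_line (S, \<pi>)))) *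
      t ^ word_exc n (one_line (S, \<pi>))"
  have "(\<Sum>\<sigma>\<in>dec_perms n. ?f \<sigma>) = (\<Sum>S\<in>Pow {1..n}. \<Sum>\<pi> | \<pi> permutes S. ?f (S, \<pi>))"
  proof -
    have "dec_perms n = Sigma (Pow {1..n}) (\<lambda>S. {\<pi>. \<pi> permutes S})"
      by (auto simp: dec_perms_def)
    moreover have "\<forall>S\<in>Pow {1..n}. finite {\<pi>. \<pi> permutes S}"
      by (auto intro!: finite_permutations intro: finite_subset)
    ultimately show ?thesis by (simp add: sum.Sigma case_prod_unfold)
  qed
  also have "\<dots> = (\<Sum>k\<in>{0..n}. \<Sum>S\<in>k_subsets n k. \<Sum>\<pi> | \<pi> permutes S. ?f (S, \<pi>))"
  proof -
    have "card ` Pow {1..n} \<subseteq> {0..n}"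
      using card_mono[of "{1..n}"] by auto
    then have "(\<Sum>k\<in>{0..n}. \<Sum>S | S \<in> Pow {1..n} \<and> card S = k. \<Sum>\<pi> | \<pi> permutes S. ?f (S, \<pi>)) =
        (\<Sum>S\<in>Pow {1..n}. \<Sum>\<pi> | \<pi> permutes S. ?f (S, \<pi>))"
      by (intro sum.group) auto
    then show ?thesis by (simp add: k_subsets_def)
  qed
  \<comment> \<open>The only term with \<open>k = 0\<close> is \<open>dec_theta\<close>; its values
    -1 make both exponents 0.\<close>
  also have "\<dots> = 1 + (\<Sum>k=1..n. \<Sum>S\<in>k_subsets n k. \<Sum>\<pi> | \<pi> permutes S. ?f (S, \<pi>))"
    by (simp add: sum.atLeast_Suc_atMost k_subsets_0 permutes_empty dec_maj_def dec_exc_def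
        dec_theta_def)
  also have "(\<Sum>k=1..n. \<Sum>S\<in>k_subsets n k. \<Sum>\<pi> | \<pi> permutes S. ?f (S, \<pi>)) =
      (\<Sum>k=1..n. t * (q_binomial q n k * Eulerian_qt q t k))"
  proof (intro sum.cong refl)
    fix k assume k: "k \<in> {1..n}"
    have "?f (S, \<pi>) = t * ?h S \<pi>" if "S \<in> k_subsets n k" for S \<pi>
    proof -
      have "(S, \<pi>) \<noteq> dec_theta" using that k by (auto simp: dec_theta_def k_subsets_def)
      moreover have "t powi (int m + 1) = t * t ^ m" for m
        using power_int_of_nat[of t "Suc m"] by (simp add: add.commute)
      ultimately show ?thesis by (simp add: dec_maj_def dec_exc_def mult_ac)
    qed
    then have "(\<Sum>S\<in>k_subsets n k. \<Sum>\<pi> | \<pi> permutes S. ?f (S, \<pi>)) =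
        t * (\<Sum>S\<in>k_subsets n k. \<Sum>\<pi> | \<pi> permutes S. ?h S \<pi>)"
      unfolding sum_distrib_left by (intro sum.cong refl)
    also have "\<dots> = t * (q_binomial q n k * Eulerian_qt q t k)"
      using k by (simp only: sum_dec_perms_k_subsets[OF q]
          q_binomial_eq_gauss_binomial[OF bracket] atLeastAtMost_iff)
    finally show "(\<Sum>S\<in>k_subsets n k. \<Sum>\<pi> | \<pi> permutes S. ?f (S, \<pi>)) =
        t * (q_binomial q n k * Eulerian_qt q t k)" .
  qed
  finally show ?thesis by (simp add: q_binomial_Eulerian_def sum_distrib_left)
qed

section \<open>Specialisation to the indeterminates\<close>

lemma q_bracket_q_ind_nonzero:
  assumes "i > 0"
  shows "q_bracket q_ind i \<noteq> 0"
proof -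
  have pow: "q_ind ^ j = to_fract ([:[:0, 1:]:] ^ j)" for j
    by (induction j) (simp_all add: q_ind_def flip: to_fract_mult)
  have eq: "q_bracket q_ind i = to_fract (\<Sum>j<i. [:[:0, 1:]:] ^ j)"
    unfolding q_bracket_def pow by (induction i) simp_all
  \<comment> \<open>The outer variable is t and the inner one q: at t = 0, q = 1 the bracket takes
    the nonzero value \<open>i\<close>.\<close>
  have "poly (poly (\<Sum>j<i. [:[:0, 1:]:] ^ j) 0) 1 = int i"
    by (simp add: poly_sum poly_power)
  then have "(\<Sum>j<i. [:[:0, 1:]:] ^ j) \<noteq> (0 :: int poly poly)"
    using assms by auto
  then show ?thesis by (simp only: eq to_fract_eq_0_iff not_False_eq_True)
qed

theorem theorem6p18:
  fixes n :: nat
  shows "q_binomial_Eulerian q_ind t_ind n =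
    (\<Sum>\<sigma>\<in>dec_perms n. q_ind powi (dec_maj n \<sigma> - dec_exc n \<sigma>) * t_ind powi (dec_exc n \<sigma> + 1))"
  by (rule q_binomial_Eulerian_eq_sum_dec_perms)
    (simp add: q_ind_def, rule q_bracket_q_ind_nonzero)

end
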